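(* Let $H$ be a non-separable Hilbert space and let $T\in B(H)$ be a bounded operator. Then the following statements are equivalent: 1) $H_1:=\ker(T)^{\perp}$ is separable. 2) $H_2:=\operatorname{ran}(T)=T(H)$ is separable. Moreover, every operator satisfying these conditions has a local unit, and the space $\mathcal{A}\subset B(H)$ of all operators satisfying these conditions forms a non-unital locally unital $C^*$-algebra.
   Context: A self-adjoint element $h$ of a $C^*$-algebra $\mathcal{A}$ is a local unit for $a\in\mathcal{A}$ if $ah=ha=a$. A $C^*$-algebra $\mathcal{A}$ is locally unital if every $a\in\mathcal{A}$ has a local unit in $\mathcal{A}$. $B(H)$ is the $C^*$-algebra of bounded operators on $H$. *)

theory Defs
  imports "HOL-Analysis.Analysis"
begin

section \<open>Complex Hilbert spaces\<close>

class complex_vector = real_vector +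
  fixes scaleC :: "complex \<Rightarrow> 'a \<Rightarrow> 'a"  (infixr \<open>*\<^sub>C\<close> 75)
  assumes scaleC_add_right: "c *\<^sub>C (x + y) = c *\<^sub>C x + c *\<^sub>C y"
    and scaleC_add_left: "(c + d) *\<^sub>C x = c *\<^sub>C x + d *\<^sub>C x"
    and scaleC_scaleC: "c *\<^sub>C d *\<^sub>C x = (c * d) *\<^sub>C x"
    and scaleC_one: "1 *\<^sub>C x = x"
    and scaleR_scaleC: "r *\<^sub>R x = complex_of_real r *\<^sub>C x"

text \<open>The inner product is linear in the first and antilinear in the second argument.\<close>

class complex_inner = complex_vector + real_normed_vector +
  fixes cinner :: "'a \<Rightarrow> 'a \<Rightarrow> complex"
  assumes cinner_commute: "cinner x y = cnj (cinner y x)"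
    and cinner_add_left: "cinner (x + y) z = cinner x z + cinner y z"
    and cinner_scaleC_left: "cinner (c *\<^sub>C x) y = c * cinner x y"
    and cinner_self_real: "cinner x x \<in> \<real>"
    and cinner_self_ge_zero: "0 \<le> Re (cinner x x)"
    and cinner_eq_zero_iff: "cinner x x = 0 \<longleftrightarrow> x = 0"
    and norm_eq_sqrt_cinner: "norm x = sqrt (Re (cinner x x))"

class complex_hilbert_space = complex_inner + complete_space
begin

subclass banach ..

end

definition orthogonal_complement :: "'a::complex_inner set \<Rightarrow> 'a set"
  where "orthogonal_complement S = {x. \<forall>y\<in>S. cinner x y = 0}"

lemma norm_scaleC:
  fixes x :: "'a::complex_inner"
  shows "norm (c *\<^sub>C x) = norm c * norm x"
proof -
  have "cinner (c *\<^sub>C x) (c *\<^sub>C x) = c * cnj (c * cinner x x)"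
    by (metis cinner_commute cinner_scaleC_left)
  also have "\<dots> = c * cnj c * cinner x x"
    using cinner_commute[of x x] by simp
  finally have "Re (cinner (c *\<^sub>C x) (c *\<^sub>C x)) = (norm c)\<^sup>2 * Re (cinner x x)"
    by (simp add: complex_mult_cnj cmod_power2)
  then show ?thesis
    by (simp add: norm_eq_sqrt_cinner real_sqrt_mult)
qed

section \<open>$C^*$-algebras, possibly without unit\<close>

record 'b star_algebra =
  carrier :: "'b set"
  zero :: 'b  (\<open>\<zero>\<index>\<close>)
  add :: "'b \<Rightarrow> 'b \<Rightarrow> 'b"  (infixl \<open>\<oplus>\<index>\<close> 65)
  scale :: "complex \<Rightarrow> 'b \<Rightarrow> 'b"  (infixr \<open>\<odot>\<index>\<close> 75)
  mult :: "'b \<Rightarrow> 'b \<Rightarrow> 'b"  (infixl \<open>\<otimes>\<index>\<close> 70)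
  star :: "'b \<Rightarrow> 'b"
  nrm :: "'b \<Rightarrow> real"

locale cstar_algebra =
  fixes A :: "('b, 'm) star_algebra_scheme" (structure)
  assumes zero_closed: "\<zero> \<in> carrier A"
    and add_closed: "\<lbrakk>x \<in> carrier A; y \<in> carrier A\<rbrakk> \<Longrightarrow> x \<oplus> y \<in> carrier A"
    and scale_closed: "x \<in> carrier A \<Longrightarrow> c \<odot> x \<in> carrier A"
    and mult_closed: "\<lbrakk>x \<in> carrier A; y \<in> carrier A\<rbrakk> \<Longrightarrow> x \<otimes> y \<in> carrier A"
    and star_closed: "x \<in> carrier A \<Longrightarrow> star A x \<in> carrier A"
    and add_assoc: "\<lbrakk>x \<in> carrier A; y \<in> carrier A; z \<in> carrier A\<rbrakk>
      \<Longrightarrow> (x \<oplus> y) \<oplus> z = x \<oplus> (y \<oplus> z)"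
    and add_commute: "\<lbrakk>x \<in> carrier A; y \<in> carrier A\<rbrakk> \<Longrightarrow> x \<oplus> y = y \<oplus> x"
    and add_zero: "x \<in> carrier A \<Longrightarrow> x \<oplus> \<zero> = x"
    and add_inverse: "x \<in> carrier A \<Longrightarrow> \<exists>y\<in>carrier A. x \<oplus> y = \<zero>"
    and scale_add_right: "\<lbrakk>x \<in> carrier A; y \<in> carrier A\<rbrakk> \<Longrightarrow> c \<odot> (x \<oplus> y) = c \<odot> x \<oplus> c \<odot> y"
    and scale_add_left: "x \<in> carrier A \<Longrightarrow> (c + d) \<odot> x = c \<odot> x \<oplus> d \<odot> x"
    and scale_scale: "x \<in> carrier A \<Longrightarrow> c \<odot> d \<odot> x = (c * d) \<odot> x"
    and scale_one: "x \<in> carrier A \<Longrightarrow> 1 \<odot> x = x"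
    and mult_assoc: "\<lbrakk>x \<in> carrier A; y \<in> carrier A; z \<in> carrier A\<rbrakk>
      \<Longrightarrow> (x \<otimes> y) \<otimes> z = x \<otimes> (y \<otimes> z)"
    and mult_add_left: "\<lbrakk>x \<in> carrier A; y \<in> carrier A; z \<in> carrier A\<rbrakk>
      \<Longrightarrow> (x \<oplus> y) \<otimes> z = x \<otimes> z \<oplus> y \<otimes> z"
    and mult_add_right: "\<lbrakk>x \<in> carrier A; y \<in> carrier A; z \<in> carrier A\<rbrakk>
      \<Longrightarrow> x \<otimes> (y \<oplus> z) = x \<otimes> y \<oplus> x \<otimes> z"
    and mult_scale_left: "\<lbrakk>x \<in> carrier A; y \<in> carrier A\<rbrakk> \<Longrightarrow> (c \<odot> x) \<otimes> y = c \<odot> (x \<otimes> y)"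
    and mult_scale_right: "\<lbrakk>x \<in> carrier A; y \<in> carrier A\<rbrakk> \<Longrightarrow> x \<otimes> (c \<odot> y) = c \<odot> (x \<otimes> y)"
    and star_add: "\<lbrakk>x \<in> carrier A; y \<in> carrier A\<rbrakk> \<Longrightarrow> star A (x \<oplus> y) = star A x \<oplus> star A y"
    and star_scale: "x \<in> carrier A \<Longrightarrow> star A (c \<odot> x) = cnj c \<odot> star A x"
    and star_mult: "\<lbrakk>x \<in> carrier A; y \<in> carrier A\<rbrakk> \<Longrightarrow> star A (x \<otimes> y) = star A y \<otimes> star A x"
    and star_star: "x \<in> carrier A \<Longrightarrow> star A (star A x) = x"
    and nrm_nonneg: "x \<in> carrier A \<Longrightarrow> 0 \<le> nrm A x"
    and nrm_eq_zero_iff: "x \<in> carrier A \<Longrightarrow> nrm A x = 0 \<longleftrightarrow> x = \<zero>"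
    and nrm_scale: "x \<in> carrier A \<Longrightarrow> nrm A (c \<odot> x) = cmod c * nrm A x"
    and nrm_triangle: "\<lbrakk>x \<in> carrier A; y \<in> carrier A\<rbrakk> \<Longrightarrow> nrm A (x \<oplus> y) \<le> nrm A x + nrm A y"
    and nrm_mult: "\<lbrakk>x \<in> carrier A; y \<in> carrier A\<rbrakk> \<Longrightarrow> nrm A (x \<otimes> y) \<le> nrm A x * nrm A y"
    and cstar_identity: "x \<in> carrier A \<Longrightarrow> nrm A (star A x \<otimes> x) = (nrm A x)\<^sup>2"
    and complete: "Metric_space.mcomplete (carrier A) (\<lambda>x y. nrm A (x \<oplus> (-1) \<odot> y))"

definition unital :: "('b, 'm) star_algebra_scheme \<Rightarrow> bool"
  where "unital A \<longleftrightarrow> (\<exists>e\<in>carrier A. \<forall>a\<in>carrier A. mult A e a = a \<and> mult A a e = a)"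

definition local_unit :: "('b, 'm) star_algebra_scheme \<Rightarrow> 'b \<Rightarrow> 'b \<Rightarrow> bool"
  where "local_unit A h a \<longleftrightarrow>
    h \<in> carrier A \<and> star A h = h \<and> mult A a h = a \<and> mult A h a = a"

definition locally_unital :: "('b, 'm) star_algebra_scheme \<Rightarrow> bool"
  where "locally_unital A \<longleftrightarrow> (\<forall>a\<in>carrier A. \<exists>h. local_unit A h a)"

section \<open>Bounded operators on a Hilbert space\<close>

lift_definition scaleC_blinfun :: "complex \<Rightarrow> ('a::complex_inner \<Rightarrow>\<^sub>L 'a) \<Rightarrow> ('a \<Rightarrow>\<^sub>L 'a)"
  is "\<lambda>c f x. c *\<^sub>C f x"
proof -
  fix c :: complex and f :: "'a \<Rightarrow> 'a"
  assume f: "bounded_linear f"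
  have "bounded_linear (\<lambda>x::'a. c *\<^sub>C x)"
  proof (rule bounded_linear_intro[where K = "norm c"])
    show "c *\<^sub>C (x + y) = c *\<^sub>C x + c *\<^sub>C y" for x y :: 'a
      by (rule scaleC_add_right)
    show "c *\<^sub>C (r *\<^sub>R x) = r *\<^sub>R (c *\<^sub>C x)" for r and x :: 'a
      by (simp add: scaleR_scaleC scaleC_scaleC mult.commute)
    show "norm (c *\<^sub>C x) \<le> norm x * norm c" for x :: 'a
      by (simp add: norm_scaleC mult.commute)
  qed
  then show "bounded_linear (\<lambda>x. c *\<^sub>C f x)"
    using f by (rule bounded_linear_compose)
qed

text \<open>On a Hilbert space the adjoint of a bounded complex-linear operator exists and is unique, so
  that the description below is proper.\<close>

definition cadjoint :: "('a::complex_hilbert_space \<Rightarrow>\<^sub>L 'a) \<Rightarrow> ('a \<Rightarrow>\<^sub>L 'a)"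
  where "cadjoint T = (THE S :: 'a \<Rightarrow>\<^sub>L 'a. \<forall>x y. cinner (S x) y = cinner x (T y))"

text \<open>The elements of \<^typ>\<open>'a \<Rightarrow>\<^sub>L 'a\<close> are the real-linear bounded maps; $B(H)$ consists of the
  complex-linear ones among them, with the operator norm.\<close>

definition bounded_operators :: "('a::complex_hilbert_space \<Rightarrow>\<^sub>L 'a) star_algebra"  (\<open>\<B>\<close>)
  where "\<B> =
    \<lparr>carrier = {T :: 'a \<Rightarrow>\<^sub>L 'a. \<forall>c x. T (c *\<^sub>C x) = c *\<^sub>C T x},
     zero = 0, add = (+), scale = scaleC_blinfun, mult = (o\<^sub>L), star = cadjoint, nrm = norm\<rparr>"

definition op_kernel :: "('a::complex_hilbert_space \<Rightarrow>\<^sub>L 'a) \<Rightarrow> 'a set"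
  where "op_kernel T = {x. T x = 0}"

abbreviation separable :: "'a::topological_space set \<Rightarrow> bool"
  where "separable S \<equiv> separable_space (top_of_set S)"

definition separable_operators :: "('a::complex_hilbert_space \<Rightarrow>\<^sub>L 'a) star_algebra"  (\<open>\<A>\<close>)
  where "\<A> = \<B>\<lparr>carrier := {T \<in> carrier \<B>.
    separable (orthogonal_complement (op_kernel T)) \<and> separable (range T)}\<rparr>"

end

theory Submission
  imports Defs
begin

text \<open>
  Taking adjoints preserves separability of the range, and everything else follows from that.  Let
  \<open>P\<close> be the orthogonal projection onto the closure of \<open>ran T\<close>.  Then \<open>P T = T\<close>, and taking adjoints
  gives \<open>T* = T* P\<close>, so that \<open>ran T*\<close> lies in the image under \<open>T*\<close> of the closure of \<open>ran T\<close>, which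
  is separable if \<open>ran T\<close> is (\<open>separable_range_cadjoint\<close>).  Since \<open>T** = T\<close>, the operators \<open>T\<close> and
  \<open>T*\<close> have separable ranges simultaneously.  The orthogonal complement of \<open>ker T\<close> lies between
  \<open>ran T*\<close> and its closure (\<open>orthogonal_complement_op_kernel\<close>), which turns this into the equivalence
  of the two conditions.

  A local unit for \<open>T\<close> is the projection \<open>h\<close> onto the closure of \<open>ran T + ran T*\<close>: it fixes both
  ranges, so \<open>h T = T\<close> and \<open>h T* = T*\<close>, and the adjoint of the latter is \<open>T h = T\<close>.

  Membership in the algebra is thus a condition on the range only, and sums, multiples, products,
  adjoints and norm limits of operators with separable range again have separable range.  For norm
  limits, the range of the limit lies in the closure of the union of countably many separable ranges.
  The remaining \<open>C*\<close>-axioms are those of \<open>B(H)\<close>.  A unit would have to fix the range of every rank-one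
  operator, so it would be the identity and \<open>H\<close> its range, hence separable.

  Projections and adjoints rest on the existence of nearest points in closed subspaces of a Hilbert
  space (\<open>closed_csubspace_minimizer\<close>) and on the Riesz representation theorem derived from it.
\<close>


section \<open>Inner products\<close>

lemma cinner_add_right: "cinner x (y + z) = cinner x y + cinner x z"
  by (metis cinner_add_left cinner_commute complex_cnj_add)

lemma cinner_scaleC_right: "cinner x (c *\<^sub>C y) = cnj c * cinner x y"
  by (metis cinner_commute cinner_scaleC_left complex_cnj_mult)

lemma cinner_scaleR_left: "cinner (r *\<^sub>R x) y = complex_of_real r * cinner x y"
  by (simp add: scaleR_scaleC cinner_scaleC_left)

lemma cinner_scaleR_right: "cinner x (r *\<^sub>R y) = complex_of_real r * cinner x y"
  by (simp add: scaleR_scaleC cinner_scaleC_right)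

lemma cinner_minus_left: "cinner (- x) y = - cinner x y"
  using cinner_scaleR_left[of "-1"] by simp

lemma cinner_minus_right: "cinner x (- y) = - cinner x y"
  using cinner_scaleR_right[of _ "-1"] by simp

lemma cinner_diff_left: "cinner (x - y) z = cinner x z - cinner y z"
  by (simp only: diff_conv_add_uminus cinner_add_left cinner_minus_left)

lemma cinner_diff_right: "cinner x (y - z) = cinner x y - cinner x z"
  by (simp only: diff_conv_add_uminus cinner_add_right cinner_minus_right)

lemma cinner_zero_left [simp]: "cinner 0 x = 0"
  using cinner_diff_left[of 0 0] by simp

lemma cinner_zero_right [simp]: "cinner x 0 = 0"
  using cinner_diff_right[of _ 0 0] by simp

lemmas cinner_simps = cinner_add_left cinner_add_right cinner_diff_left cinner_diff_right
  cinner_scaleC_left cinner_scaleC_right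

lemma cinner_self: "cinner x x = complex_of_real ((norm x)\<^sup>2)"
  using cinner_self_real[of x] cinner_self_ge_zero[of x]
  by (simp add: norm_eq_sqrt_cinner complex_is_Real_iff complex_eq_iff)

lemma scaleC_zero_right [simp]: "c *\<^sub>C (0::'a::complex_inner) = 0"
  using norm_scaleC[of c "0::'a"] by simp

lemma norm_diff_power2:
  fixes x y :: "'a::complex_inner"
  shows "(norm (x - y))\<^sup>2 = (norm x)\<^sup>2 - 2 * Re (cinner x y) + (norm y)\<^sup>2"
proof -
  have "cinner (x - y) (x - y) = cinner x x - (cinner x y + cnj (cinner x y)) + cinner y y"
    using cinner_commute[of y x] by (simp add: cinner_simps)
  then have "Re (cinner (x - y) (x - y)) = Re (cinner x x - (cinner x y + cnj (cinner x y)) + cinner y y)"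
    by (rule arg_cong)
  then show ?thesis
    by (simp add: cinner_self)
qed

lemma norm_add_power2:
  fixes x y :: "'a::complex_inner"
  shows "(norm (x + y))\<^sup>2 = (norm x)\<^sup>2 + 2 * Re (cinner x y) + (norm y)\<^sup>2"
  using norm_diff_power2[of x "- y"] by (simp add: cinner_minus_right)

lemma parallelogram_law:
  fixes x y :: "'a::complex_inner"
  shows "(norm (x + y))\<^sup>2 + (norm (x - y))\<^sup>2 = 2 * (norm x)\<^sup>2 + 2 * (norm y)\<^sup>2"
  by (simp add: norm_add_power2 norm_diff_power2)

text \<open>The scalar is the one minimising the distance from \<^term>\<open>x\<close> to the line through \<^term>\<open>z\<close>.
  Nonnegativity of the left-hand side is the Cauchy--Schwarz inequality, and a strict decrease of the
  norm whenever \<^term>\<open>cinner x z \<noteq> 0\<close> is what forces a nearest point to be an orthogonal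
  projection.\<close>

lemma norm_sub_projection:
  fixes x z :: "'a::complex_inner"
  assumes "z \<noteq> 0"
  shows "(norm (x - (cinner x z / complex_of_real ((norm z)\<^sup>2)) *\<^sub>C z))\<^sup>2
    = (norm x)\<^sup>2 - (cmod (cinner x z))\<^sup>2 / (norm z)\<^sup>2"
proof -
  let ?c = "cinner x z / complex_of_real ((norm z)\<^sup>2)"
  have "cnj (cinner x z) * cinner x z = complex_of_real ((cmod (cinner x z))\<^sup>2)"
    by (metis complex_norm_square mult.commute)
  then have "cinner x (?c *\<^sub>C z) = complex_of_real ((cmod (cinner x z))\<^sup>2 / (norm z)\<^sup>2)"
    by (simp add: cinner_scaleC_right)
  then have "Re (cinner x (?c *\<^sub>C z)) = (cmod (cinner x z))\<^sup>2 / (norm z)\<^sup>2"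
    by (simp only: Re_complex_of_real)
  moreover have "(norm (?c *\<^sub>C z))\<^sup>2 = (cmod (cinner x z))\<^sup>2 / (norm z)\<^sup>2"
    using assms by (simp add: norm_scaleC norm_divide norm_mult norm_power power2_eq_square)
  ultimately show ?thesis
    unfolding norm_diff_power2 by simp
qed

lemma cinner_Cauchy_Schwarz:
  fixes x y :: "'a::complex_inner"
  shows "cmod (cinner x y) \<le> norm x * norm y"
proof (cases "y = 0")
  case False
  have "0 \<le> (norm x)\<^sup>2 - (cmod (cinner x y))\<^sup>2 / (norm y)\<^sup>2"
    using norm_sub_projection[OF False, of x] by (metis zero_le_power2)
  then have "(cmod (cinner x y))\<^sup>2 \<le> (norm x * norm y)\<^sup>2"
    using False by (simp add: field_simps power_mult_distrib)
  then show ?thesis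
    by (rule power2_le_imp_le) simp
qed simp

lemma bounded_linear_cinner_left: "bounded_linear (\<lambda>x. cinner x (y::'a::complex_inner))"
  by (rule bounded_linear_intro[where K = "norm y"])
    (simp_all add: cinner_add_left cinner_scaleR_left cinner_Cauchy_Schwarz scaleR_conv_of_real)

lemma cinner_eqI:
  assumes "\<And>z. cinner x z = cinner y z"
  shows "x = y"
proof -
  have "cinner (x - y) (x - y) = 0"
    by (simp add: cinner_diff_left assms)
  then show ?thesis
    by (simp add: cinner_eq_zero_iff)
qed

lemma bounded_linear_scaleC_right: "bounded_linear (\<lambda>x::'a::complex_inner. c *\<^sub>C x)"
  by (rule bounded_linear_intro[where K = "cmod c"])
    (simp_all add: scaleC_add_right scaleR_scaleC scaleC_scaleC norm_scaleC mult.commute)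

lemma bounded_linear_scaleC_left: "bounded_linear (\<lambda>c. c *\<^sub>C (x::'a::complex_inner))"
  by (rule bounded_linear_intro[where K = "norm x"])
    (simp_all add: scaleC_add_left scaleR_scaleC scaleC_scaleC norm_scaleC scaleR_conv_of_real)

lemma scaleC_minus_one: "(-1) *\<^sub>C x = - (x::'a::complex_inner)"
  using scaleR_scaleC[of "-1" x] by simp


section \<open>Orthogonal projections and the Riesz representation theorem\<close>

definition csubspace :: "'a::complex_inner set \<Rightarrow> bool"
  where "csubspace M \<longleftrightarrow> 0 \<in> M \<and> (\<forall>x\<in>M. \<forall>y\<in>M. x + y \<in> M) \<and> (\<forall>c. \<forall>x\<in>M. c *\<^sub>C x \<in> M)"

lemma csubspace_diff: "csubspace M \<Longrightarrow> x \<in> M \<Longrightarrow> y \<in> M \<Longrightarrow> x - y \<in> M"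
  unfolding csubspace_def by (metis diff_conv_add_uminus scaleC_minus_one)

lemma csubspace_plus:
  assumes "csubspace M" and "csubspace N"
  shows "csubspace (M + N)"
  unfolding csubspace_def
proof (intro conjI ballI allI)
  show "0 \<in> M + N"
    using assms by (metis csubspace_def set_plus_intro add_0)
next
  fix x y assume "x \<in> M + N" "y \<in> M + N"
  then obtain a b c d where "x = a + b" "y = c + d" "a \<in> M" "b \<in> N" "c \<in> M" "d \<in> N"
    by (metis set_plus_elim)
  then have "x + y = (a + c) + (b + d)" "a + c \<in> M" "b + d \<in> N"
    using assms by (auto simp: csubspace_def)
  then show "x + y \<in> M + N"
    by auto
next
  fix c x assume "x \<in> M + N"
  then obtain a b where "x = a + b" "a \<in> M" "b \<in> N"
    by (metis set_plus_elim)
  then show "c *\<^sub>C x \<in> M + N"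
    using assms by (auto simp: csubspace_def scaleC_add_right)
qed

lemma csubspace_closure:
  assumes "csubspace M"
  shows "csubspace (closure M)"
  unfolding csubspace_def
proof (intro conjI ballI allI)
  show "0 \<in> closure M"
    using assms closure_subset unfolding csubspace_def by blast
next
  fix x y assume "x \<in> closure M" "y \<in> closure M"
  then have "x + y \<in> closure (M + M)"
    using closure_sum[of M M] by (auto simp: set_plus_def)
  moreover have "M + M \<subseteq> M"
    using assms unfolding csubspace_def set_plus_def by blast
  ultimately show "x + y \<in> closure M"
    using closure_mono by blast
next
  fix c x assume "x \<in> closure M"
  then have "c *\<^sub>C x \<in> closure ((\<lambda>x. c *\<^sub>C x) ` M)"
    using closure_bounded_linear_image_subset[OF bounded_linear_scaleC_right[of c], of M] by blast
  moreover have "(\<lambda>x. c *\<^sub>C x) ` M \<subseteq> M"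
    using assms unfolding csubspace_def by blast
  ultimately show "c *\<^sub>C x \<in> closure M"
    using closure_mono by blast
qed

text \<open>If \<^term>\<open>x - y\<close> had a nonzero inner product with some \<^term>\<open>z\<close> in \<^term>\<open>M\<close>, subtracting its
  component along \<^term>\<open>z\<close> would give a point of \<^term>\<open>M\<close> closer to \<^term>\<open>x\<close> than \<^term>\<open>y\<close>.\<close>

lemma minimizer_orthogonal:
  fixes x y :: "'a::complex_inner"
  assumes M: "csubspace M" and y: "y \<in> M" and min: "\<And>z. z \<in> M \<Longrightarrow> norm (x - y) \<le> norm (x - z)"
  shows "x - y \<in> orthogonal_complement M"
proof -
  have "cinner (x - y) z = 0" if z: "z \<in> M" for z
  proof (cases "z = 0")
    case False
    let ?c = "cinner (x - y) z / complex_of_real ((norm z)\<^sup>2)"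
    have "y + ?c *\<^sub>C z \<in> M"
      using M y z unfolding csubspace_def by blast
    then have "norm (x - y) \<le> norm (x - y - ?c *\<^sub>C z)"
      using min by (metis diff_diff_eq)
    then have "(norm (x - y))\<^sup>2 \<le> (norm (x - y - ?c *\<^sub>C z))\<^sup>2"
      by (simp add: power_mono)
    then have "(cmod (cinner (x - y) z))\<^sup>2 / (norm z)\<^sup>2 \<le> 0"
      unfolding norm_sub_projection[OF False] by simp
    then show ?thesis
      using False by (simp add: divide_le_0_iff)
  qed simp
  then show ?thesis
    by (simp add: orthogonal_complement_def)
qed

text \<open>A minimising sequence is Cauchy: the midpoint of two of its terms lies in \<^term>\<open>M\<close>, hence at least
  as far from \<^term>\<open>x\<close> as the infimum, and the parallelogram law then bounds the distance of the two
  terms by how far they are from being optimal.\<close>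

lemma closed_csubspace_minimizer:
  fixes x :: "'a::complex_hilbert_space"
  assumes M: "csubspace M" and "closed M"
  shows "\<exists>y\<in>M. \<forall>z\<in>M. norm (x - y) \<le> norm (x - z)"
proof -
  define d where "d = infdist x M"
  have ne: "M \<noteq> {}"
    using M unfolding csubspace_def by blast
  have d: "d \<le> norm (x - z)" if "z \<in> M" for z
    using infdist_le[OF that, of x] by (simp add: d_def dist_norm)
  have d0: "0 \<le> d"
    by (simp add: d_def infdist_nonneg)
  have "\<exists>y\<in>M. (norm (x - y))\<^sup>2 < d\<^sup>2 + inverse (Suc n)" for n
  proof -
    have "d < sqrt (d\<^sup>2 + inverse (Suc n))"
      using d0 by (intro real_less_rsqrt) simp
    then obtain y where "y \<in> M" "dist x y < sqrt (d\<^sup>2 + inverse (Suc n))"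
      using ne cInf_lessD[of "dist x ` M"] unfolding d_def infdist_notempty[OF ne] by auto
    then show ?thesis
      by (metis dist_norm norm_ge_zero real_less_lsqrt real_sqrt_less_iff real_sqrt_abs abs_norm_cancel)
  qed
  then obtain Y where Y: "\<And>n. Y n \<in> M" "\<And>n. (norm (x - Y n))\<^sup>2 < d\<^sup>2 + inverse (Suc n)"
    by metis
  have close: "(norm (Y m - Y n))\<^sup>2 \<le> 2 * inverse (Suc m) + 2 * inverse (Suc n)" for m n
  proof -
    have "(1/2) *\<^sub>R (Y m + Y n) \<in> M"
      using M Y(1) unfolding csubspace_def scaleR_scaleC by blast
    then have "d\<^sup>2 \<le> (norm (x - (1/2) *\<^sub>R (Y m + Y n)))\<^sup>2"
      using d d0 power_mono by blast
    moreover have "(x - Y m) + (x - Y n) = 2 *\<^sub>R (x - (1/2) *\<^sub>R (Y m + Y n))"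
      by (simp add: algebra_simps scaleR_2)
    then have "(norm ((x - Y m) + (x - Y n)))\<^sup>2 = 4 * (norm (x - (1/2) *\<^sub>R (Y m + Y n)))\<^sup>2"
      by (simp only: norm_scaleR power_mult_distrib) simp
    moreover have "norm ((x - Y m) - (x - Y n)) = norm (Y m - Y n)"
      by (simp add: norm_minus_commute)
    ultimately show ?thesis
      using parallelogram_law[of "x - Y m" "x - Y n"] Y(2)[of m] Y(2)[of n] by simp
  qed
  have "Cauchy Y"
  proof (rule metric_CauchyI)
    fix e :: real assume e: "e > 0"
    then obtain N where N: "inverse (real (Suc N)) < e\<^sup>2 / 4"
      using reals_Archimedean[of "e\<^sup>2 / 4"] by auto
    have "dist (Y m) (Y n) < e" if "m \<ge> N" "n \<ge> N" for m n
    proof -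
      have "inverse (real (Suc m)) \<le> inverse (real (Suc N))" "inverse (real (Suc n)) \<le> inverse (real (Suc N))"
        using that by simp_all
      then have "(norm (Y m - Y n))\<^sup>2 < e\<^sup>2"
        using close[of m n] N by linarith
      then show ?thesis
        using e by (simp add: dist_norm power2_less_imp_less)
    qed
    then show "\<exists>N. \<forall>m\<ge>N. \<forall>n\<ge>N. dist (Y m) (Y n) < e"
      by blast
  qed
  then obtain y where y: "Y \<longlonglongrightarrow> y"
    by (meson Cauchy_convergent convergent_def)
  have yM: "y \<in> M"
    using \<open>closed M\<close> Y(1) y by (metis closed_sequentially)
  have "(norm (x - y))\<^sup>2 \<le> d\<^sup>2"
  proof (rule LIMSEQ_le)
    show "(\<lambda>n. (norm (x - Y n))\<^sup>2) \<longlonglongrightarrow> (norm (x - y))\<^sup>2"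
      by (intro tendsto_intros y)
    show "(\<lambda>n. d\<^sup>2 + inverse (real (Suc n))) \<longlonglongrightarrow> d\<^sup>2"
      using tendsto_add[OF tendsto_const LIMSEQ_inverse_real_of_nat] by simp
    show "\<exists>N. \<forall>n\<ge>N. (norm (x - Y n))\<^sup>2 \<le> d\<^sup>2 + inverse (real (Suc n))"
      using Y(2) less_imp_le by blast
  qed
  then have "norm (x - y) \<le> d"
    using d0 power2_le_imp_le by blast
  then show ?thesis
    using yM d order_trans by blast
qed

lemma orthogonal_decomposition:
  fixes x :: "'a::complex_hilbert_space"
  assumes "csubspace M" and "closed M"
  obtains y where "y \<in> M" "x - y \<in> orthogonal_complement M"
  using closed_csubspace_minimizer[OF assms, of x] minimizer_orthogonal[OF assms(1)] by blast

text \<open>Take \<^term>\<open>z\<close> orthogonal to the kernel with \<^term>\<open>f z \<noteq> 0\<close>.  For every \<^term>\<open>w\<close> the vector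
  \<^term>\<open>f z *\<^sub>C w - f w *\<^sub>C z\<close> lies in the kernel, and its orthogonality to \<^term>\<open>z\<close>
  determines \<^term>\<open>f w\<close> as a multiple of \<^term>\<open>cinner w z\<close>.\<close>

theorem Riesz_representation:
  fixes f :: "'a::complex_hilbert_space \<Rightarrow> complex"
  assumes f: "bounded_linear f" and scale: "\<And>c x. f (c *\<^sub>C x) = c * f x"
  shows "\<exists>v. \<forall>x. f x = cinner x v"
proof (cases "\<forall>x. f x = 0")
  case True
  then show ?thesis
    by (intro exI[of _ 0]) simp
next
  case False
  then obtain x where x: "f x \<noteq> 0"
    by blast
  interpret f: bounded_linear f
    by (rule f)
  let ?M = "{x. f x = 0}"
  have "csubspace ?M"
    by (simp add: csubspace_def f.add scale f.zero)
  moreover have "closed ?M"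
    using f by (intro closed_Collect_eq linear_continuous_on continuous_on_const)
  ultimately obtain y where y: "f y = 0" and orth: "x - y \<in> orthogonal_complement ?M"
    by (metis (mono_tags) orthogonal_decomposition mem_Collect_eq)
  define z where "z = x - y"
  have fz: "f z \<noteq> 0"
    using x y by (simp add: z_def f.diff)
  then have "z \<noteq> 0"
    using f.zero by blast
  have "f w = cinner w ((cnj (f z) / complex_of_real ((norm z)\<^sup>2)) *\<^sub>C z)" for w
  proof -
    have "f (f z *\<^sub>C w - f w *\<^sub>C z) = 0"
      by (simp add: f.diff scale)
    then have "cinner z (f z *\<^sub>C w - f w *\<^sub>C z) = 0"
      using orth by (simp add: orthogonal_complement_def z_def)
    then have "cinner (f z *\<^sub>C w - f w *\<^sub>C z) z = 0"
      by (metis cinner_commute complex_cnj_zero)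
    then have "f z * cinner w z = f w * complex_of_real ((norm z)\<^sup>2)"
      by (simp add: cinner_simps cinner_self)
    then show ?thesis
      using \<open>z \<noteq> 0\<close> by (simp add: cinner_scaleC_right field_simps)
  qed
  then show ?thesis
    by blast
qed


section \<open>Adjoints and projection operators\<close>

lemma carrier_bounded_operators:
  "T \<in> carrier \<B> \<longleftrightarrow> (\<forall>c x. blinfun_apply T (c *\<^sub>C x) = c *\<^sub>C blinfun_apply T x)"
  by (simp add: bounded_operators_def)

lemma scaleC_blinfun_apply [simp]: "scaleC_blinfun c T x = c *\<^sub>C T x"
  by (simp add: scaleC_blinfun.rep_eq)

text \<open>A pointwise adjoint is linear because it is determined by its inner products, and bounded
  because \<open>\<parallel>S x\<parallel>\<^sup>2 = \<langle>x, T (S x)\<rangle> \<le> \<parallel>x\<parallel> \<parallel>T\<parallel> \<parallel>S x\<parallel>\<close>.\<close>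

lemma bounded_linear_if_adjoint:
  fixes T :: "'a::complex_hilbert_space \<Rightarrow>\<^sub>L 'a"
  assumes adj: "\<And>x y. cinner (S x) y = cinner x (T y)"
  shows "bounded_linear S"
proof (rule bounded_linear_intro[where K = "norm T"])
  show "S (x + y) = S x + S y" for x y
    by (rule cinner_eqI) (simp add: adj cinner_add_left)
  show "S (r *\<^sub>R x) = r *\<^sub>R S x" for r x
    by (rule cinner_eqI) (simp add: adj cinner_scaleR_left)
  show "norm (S x) \<le> norm x * norm T" for x
  proof (cases "S x = 0")
    case False
    have "(norm (S x))\<^sup>2 = cmod (cinner (S x) (S x))"
      by (simp only: cinner_self norm_of_real abs_power2)
    also have "\<dots> = cmod (cinner x (T (S x)))"
      by (simp add: adj)
    also have "\<dots> \<le> norm x * norm (T (S x))"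
      by (rule cinner_Cauchy_Schwarz)
    also have "\<dots> \<le> norm x * (norm T * norm (S x))"
      by (intro mult_left_mono norm_blinfun) simp
    finally show ?thesis
      using False by (simp add: power2_eq_square)
  qed simp
qed

lemma cadjoint_eqI:
  assumes "\<And>x y. cinner (blinfun_apply S x) y = cinner x (blinfun_apply T y)"
  shows "cadjoint T = S"
  unfolding cadjoint_def
proof (rule the_equality)
  show "\<forall>x y. cinner (S x) y = cinner x (T y)"
    by (simp add: assms)
next
  fix S' assume "\<forall>x y. cinner (blinfun_apply S' x) y = cinner x (blinfun_apply T y)"
  then have "S' x = S x" for x
    by (intro cinner_eqI) (simp add: assms)
  then show "S' = S"
    by (rule blinfun_eqI)
qed

lemma cinner_cadjoint_left:
  assumes "T \<in> carrier \<B>"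
  shows "cinner (cadjoint T x) y = cinner x (T y)"
proof -
  have "\<exists>v. \<forall>y. cinner (T y) x = cinner y v" for x
  proof (rule Riesz_representation)
    show "bounded_linear (\<lambda>y. cinner (T y) x)"
      by (rule bounded_linear_compose[OF bounded_linear_cinner_left blinfun.bounded_linear_right])
    show "cinner (T (c *\<^sub>C y)) x = c * cinner (T y) x" for c y
      using assms by (simp add: carrier_bounded_operators cinner_scaleC_left)
  qed
  then obtain S where S: "\<And>x y. cinner (T y) x = cinner y (S x)"
    by metis
  have adj: "cinner (S x) y = cinner x (T y)" for x y
    using S[of y x] cinner_commute[of "S x" y] cinner_commute[of x "T y"] by simp
  have "cinner (Blinfun S x) y = cinner x (T y)" for x y
    by (simp only: bounded_linear_Blinfun_apply[OF bounded_linear_if_adjoint[OF adj]] adj)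
  from cadjoint_eqI[OF this] this show ?thesis
    by simp
qed

lemma cinner_cadjoint_right:
  assumes "T \<in> carrier \<B>"
  shows "cinner x (cadjoint T y) = cinner (T x) y"
  using cinner_cadjoint_left[OF assms, of y x]
    cinner_commute[of x "cadjoint T y"] cinner_commute[of "T x" y] by simp

lemma cadjoint_closed:
  assumes "T \<in> carrier \<B>"
  shows "cadjoint T \<in> carrier \<B>"
  unfolding carrier_bounded_operators
proof (intro allI)
  show "cadjoint T (c *\<^sub>C x) = c *\<^sub>C cadjoint T x" for c x
    by (rule cinner_eqI) (simp only: cinner_scaleC_left cinner_cadjoint_left[OF assms])
qed

lemma cadjoint_cadjoint: "T \<in> carrier \<B> \<Longrightarrow> cadjoint (cadjoint T) = T"
  by (rule cadjoint_eqI) (simp only: cinner_cadjoint_right)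

lemma cadjoint_compose:
  assumes "S \<in> carrier \<B>" and "T \<in> carrier \<B>"
  shows "cadjoint (S o\<^sub>L T) = cadjoint T o\<^sub>L cadjoint S"
  by (rule cadjoint_eqI)
    (simp only: blinfun_apply_blinfun_compose cinner_cadjoint_left assms)

lemma cadjoint_add:
  assumes "S \<in> carrier \<B>" and "T \<in> carrier \<B>"
  shows "cadjoint (S + T) = cadjoint S + cadjoint T"
  by (rule cadjoint_eqI)
    (simp only: blinfun.add_left cinner_add_left cinner_add_right cinner_cadjoint_left assms)

lemma cadjoint_scaleC:
  assumes "T \<in> carrier \<B>"
  shows "cadjoint (scaleC_blinfun c T) = scaleC_blinfun (cnj c) (cadjoint T)"
  by (rule cadjoint_eqI)
    (simp only: scaleC_blinfun_apply cinner_scaleC_left cinner_scaleC_right cinner_cadjoint_left assms)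

text \<open>From \<open>\<parallel>S x\<parallel>\<^sup>2 = \<langle>S* S x, x\<rangle>\<close> one gets \<open>\<parallel>S\<parallel>\<^sup>2 \<le> \<parallel>S* S\<parallel> \<le> \<parallel>S*\<parallel> \<parallel>S\<parallel>\<close>, hence
  \<open>\<parallel>S\<parallel> \<le> \<parallel>S*\<parallel>\<close> for all \<open>S\<close>; applied to \<open>T*\<close> this bounds \<open>\<parallel>T* T\<parallel>\<close> by \<open>\<parallel>T\<parallel>\<^sup>2\<close> from above.\<close>

lemma norm_cadjoint_compose:
  assumes T: "T \<in> carrier \<B>"
  shows "norm (cadjoint T o\<^sub>L T) = (norm T)\<^sup>2"
proof -
  have le: "(norm S)\<^sup>2 \<le> norm (cadjoint S o\<^sub>L S)" if S: "S \<in> carrier \<B>" for S :: "'a \<Rightarrow>\<^sub>L 'a"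
  proof -
    let ?n = "norm (cadjoint S o\<^sub>L S)"
    have "norm (S x) \<le> sqrt ?n * norm x" for x
    proof (rule power2_le_imp_le)
      have "(norm (S x))\<^sup>2 = cmod (cinner (S x) (S x))"
        by (simp only: cinner_self norm_of_real abs_power2)
      also have "\<dots> = cmod (cinner ((cadjoint S o\<^sub>L S) x) x)"
        by (simp only: blinfun_apply_blinfun_compose cinner_cadjoint_left[OF S])
      also have "\<dots> \<le> norm ((cadjoint S o\<^sub>L S) x) * norm x"
        by (rule cinner_Cauchy_Schwarz)
      also have "\<dots> \<le> (?n * norm x) * norm x"
        by (intro mult_right_mono norm_blinfun) simp
      also have "\<dots> = (sqrt ?n * norm x)\<^sup>2"
        by (simp add: power_mult_distrib power2_eq_square)
      finally show "(norm (S x))\<^sup>2 \<le> (sqrt ?n * norm x)\<^sup>2" .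
    qed simp
    then have "norm S \<le> sqrt ?n"
      by (intro norm_blinfun_bound) simp_all
    then have "(norm S)\<^sup>2 \<le> (sqrt ?n)\<^sup>2"
      by (intro power_mono) simp_all
    then show ?thesis
      by simp
  qed
  have norm_le: "norm S \<le> norm (cadjoint S)" if S: "S \<in> carrier \<B>" for S :: "'a \<Rightarrow>\<^sub>L 'a"
  proof -
    have "norm S * norm S \<le> norm (cadjoint S) * norm S"
      using le[OF S] norm_blinfun_compose[of "cadjoint S" S] by (simp add: power2_eq_square)
    then show ?thesis
      by (cases "norm S = 0") (auto dest: mult_right_le_imp_le)
  qed
  have "norm (cadjoint T) \<le> norm T"
    using norm_le[OF cadjoint_closed[OF T]] by (simp only: cadjoint_cadjoint[OF T])
  then have "norm (cadjoint T o\<^sub>L T) \<le> norm T * norm T"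
    by (meson norm_blinfun_compose mult_right_mono norm_ge_zero order_trans)
  then show ?thesis
    using le[OF T] by (simp add: power2_eq_square)
qed

text \<open>The properties listed characterise the orthogonal projection onto \<^term>\<open>M\<close>.  Choosing an
  orthogonal decomposition at each point gives a map that is its own adjoint, and linearity follows from
  this.\<close>

lemma projection_operator:
  fixes M :: "'a::complex_hilbert_space set"
  assumes M: "csubspace M" "closed M"
  obtains P :: "'a \<Rightarrow>\<^sub>L 'a"
  where "P \<in> carrier \<B>" "cadjoint P = P" "range P \<subseteq> M" "\<And>x. x \<in> M \<Longrightarrow> P x = x"
proof -
  have "\<exists>p. \<forall>x. p x \<in> M \<and> x - p x \<in> orthogonal_complement M"
    by (rule choice) (use orthogonal_decomposition[OF M] in blast)
  then obtain p where p: "\<And>x. p x \<in> M" and orth: "\<And>x. x - p x \<in> orthogonal_complement M"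
    by blast
  \<comment> \<open>Moving \<^term>\<open>p\<close> from one argument to the other passes through \<^term>\<open>cinner (p x) (p y)\<close>.\<close>
  have left: "cinner x (p y) = cinner (p x) (p y)" for x y
    using orth[of x] p[of y] by (simp add: orthogonal_complement_def cinner_diff_left)
  have right: "cinner (p x) y = cinner (p x) (p y)" for x y
    by (metis left cinner_commute)
  have adj: "cinner (p x) y = cinner x (p y)" for x y
    by (rule trans[OF right left[symmetric]])
  have add: "p (x + y) = p x + p y" for x y
    by (rule cinner_eqI) (simp add: adj cinner_add_left)
  have scaleC: "p (c *\<^sub>C x) = c *\<^sub>C p x" for c x
    by (rule cinner_eqI) (simp add: adj cinner_scaleC_left)
  have "norm (p x) \<le> norm x" for x
  proof -
    have "cinner (p x) (x - p x) = 0"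
      using right[of x x] by (simp add: cinner_diff_right)
    then have "(norm x)\<^sup>2 = (norm (p x))\<^sup>2 + (norm (x - p x))\<^sup>2"
      using norm_add_power2[of "p x" "x - p x"] by simp
    then have "(norm (p x))\<^sup>2 \<le> (norm x)\<^sup>2"
      by simp
    then show ?thesis
      by (rule power2_le_imp_le) simp
  qed
  then have bl: "bounded_linear p"
    by (intro bounded_linear_intro[where K = 1]) (simp_all add: add scaleC scaleR_scaleC)
  have fixed: "p x = x" if "x \<in> M" for x
  proof -
    have "cinner (x - p x) (x - p x) = 0"
      using orth[of x] csubspace_diff[OF M(1) that p] by (simp add: orthogonal_complement_def)
    then show ?thesis
      by (simp add: cinner_eq_zero_iff)
  qed
  show thesis
  proof (rule that[of "Blinfun p"], unfold bounded_linear_Blinfun_apply[OF bl])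
    show "Blinfun p \<in> carrier \<B>"
      by (simp add: carrier_bounded_operators bounded_linear_Blinfun_apply[OF bl] scaleC)
    show "cadjoint (Blinfun p) = Blinfun p"
      by (rule cadjoint_eqI) (simp only: bounded_linear_Blinfun_apply[OF bl] adj)
    show "range p \<subseteq> M"
      using p by blast
    show "\<And>x. x \<in> M \<Longrightarrow> p x = x"
      by (rule fixed)
  qed
qed


section \<open>Separable sets\<close>

text \<open>The dense set need not lie inside \<^term>\<open>S\<close>, which makes the closure properties below
  immediate.  Conversely, a countable dense subset of \<^term>\<open>S\<close> itself is obtained by choosing, for each
  outside point and each \<^term>\<open>n\<close>, a point of \<^term>\<open>S\<close> at distance less than \<open>1/(n+1)\<close>, if there
  is one.\<close>

lemma separable_iff:
  fixes S :: "'a::metric_space set"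
  shows "separable S \<longleftrightarrow> (\<exists>D. countable D \<and> S \<subseteq> closure D)"
proof
  assume "separable S"
  then obtain D where "countable D" "D \<subseteq> S" "S \<inter> closure (S \<inter> D) = S"
    by (auto simp: separable_space_def closure_of_subtopology)
  then show "\<exists>D. countable D \<and> S \<subseteq> closure D"
    by (metis Int_absorb1 inf.orderI)
next
  assume "\<exists>D. countable D \<and> S \<subseteq> closure D"
  then obtain D where D: "countable D" "S \<subseteq> closure D"
    by blast
  define near where "near = (\<lambda>(a, n) y. y \<in> S \<and> dist a y < inverse (real (Suc n)))"
  define pick where "pick i = (SOME y. near i y)" for i
  have pick: "near i (pick i)" if "near i y" for i y
    unfolding pick_def using that by (rule someI)
  let ?I = "{i \<in> D \<times> (UNIV::nat set). \<exists>y. near i y}"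
  let ?E = "pick ` ?I"
  have "countable ?E"
    using D(1) by (intro countable_image countable_subset[of ?I "D \<times> UNIV"]) auto
  moreover have E: "?E \<subseteq> S"
  proof
    fix z assume "z \<in> ?E"
    then obtain i where "near i z"
      using pick by blast
    then show "z \<in> S"
      by (simp add: near_def case_prod_beta)
  qed
  moreover have "S \<subseteq> closure ?E"
  proof
    fix x assume x: "x \<in> S"
    show "x \<in> closure ?E"
      unfolding closure_approachable
    proof (intro allI impI)
      fix e :: real assume "e > 0"
      then obtain n where n: "inverse (real (Suc n)) < e / 2"
        using reals_Archimedean[of "e/2"] by auto
      obtain a where a: "a \<in> D" "dist a x < inverse (real (Suc n))"
        using D(2) x closure_approachable[of x D] by (metis inverse_positive_iff_positive of_nat_0_less_iff subsetD zero_less_Suc)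
      have near: "near (a, n) x"
        using a x by (simp add: near_def)
      then have "(a, n) \<in> ?I"
        using a(1) by blast
      then have "pick (a, n) \<in> ?E"
        by (rule imageI)
      moreover have "dist a (pick (a, n)) < inverse (real (Suc n))"
        using pick[OF near] by (simp add: near_def)
      then have "dist (pick (a, n)) x < e"
        using a(2) n dist_triangle[of "pick (a, n)" x a] dist_commute[of a "pick (a, n)"] by linarith
      ultimately show "\<exists>y\<in>?E. dist y x < e"
        by blast
    qed
  qed
  then have "S \<inter> closure (S \<inter> ?E) = S"
    using E by (simp only: Int_absorb1 Int_absorb2)
  ultimately show "separable S"
    unfolding separable_space_def closure_of_subtopology topspace_euclidean_subtopology
      euclidean_closure_of
    by (intro exI[of _ ?E] conjI E)
qed

lemma separable_subset: "separable T \<Longrightarrow> S \<subseteq> T \<Longrightarrow> separable (S::'a::metric_space set)"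
  unfolding separable_iff by blast

lemma separable_closure: "separable S \<Longrightarrow> separable (closure S :: 'a::metric_space set)"
  unfolding separable_iff by (metis closed_closure closure_minimal)

lemma separable_continuous_image:
  fixes f :: "'a::metric_space \<Rightarrow> 'b::metric_space"
  assumes "continuous_on UNIV f" and "separable S"
  shows "separable (f ` S)"
proof -
  obtain D where D: "countable D" "S \<subseteq> closure D"
    using assms(2) unfolding separable_iff by blast
  have "f ` closure D \<subseteq> closure (f ` D)"
    by (rule image_closure_subset[OF continuous_on_subset[OF assms(1)] closed_closure closure_subset]) simp
  then show ?thesis
    unfolding separable_iff using D by (meson countable_image image_mono order_trans)
qed

lemma separable_plus:
  fixes S T :: "'a::real_normed_vector set"
  assumes "separable S" and "separable T"
  shows "separable (S + T)"
proof -
  obtain C D where "countable C" "S \<subseteq> closure C" "countable D" "T \<subseteq> closure D"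
    using assms unfolding separable_iff by blast
  moreover from this have "countable (C + D)"
    unfolding set_plus_image by (intro countable_image countable_SIGMA) auto
  ultimately show ?thesis
    unfolding separable_iff by (meson closure_sum order_trans set_plus_mono2)
qed

lemma separable_countable_Union:
  fixes S :: "nat \<Rightarrow> 'a::metric_space set"
  assumes "\<And>n. separable (S n)"
  shows "separable (\<Union>n. S n)"
proof -
  obtain D where D: "\<And>n. countable (D n)" "\<And>n. S n \<subseteq> closure (D n)"
    using assms unfolding separable_iff by metis
  have "closure (D n) \<subseteq> closure (\<Union>n. D n)" for n
    by (rule closure_mono) blast
  then have "(\<Union>n. S n) \<subseteq> closure (\<Union>n. D n)"
    using D(2) by blast
  moreover have "countable (\<Union>n. D n)"
    using D(1) by blast
  ultimately show ?thesis
    unfolding separable_iff by blast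
qed

lemma separable_blinfun_image: "separable S \<Longrightarrow> separable (blinfun_apply T ` S)"
  by (rule separable_continuous_image) (intro linear_continuous_on blinfun.bounded_linear_right)


section \<open>Operators with separable range\<close>

lemma csubspace_range:
  assumes "T \<in> carrier \<B>"
  shows "csubspace (range (blinfun_apply T))"
proof -
  have "0 \<in> range T"
    using blinfun.zero_right[of T] by (metis rangeI)
  moreover have "T x + T y \<in> range T" for x y
    by (metis blinfun.add_right rangeI)
  moreover have "c *\<^sub>C T x \<in> range T" for c x
    using assms by (metis carrier_bounded_operators rangeI)
  ultimately show ?thesis
    unfolding csubspace_def by blast
qed

text \<open>The projection \<^term>\<open>P\<close> onto the closure of the range of \<^term>\<open>T\<close> satisfies \<open>P T = T\<close>, and
  taking adjoints, \<open>T* = T* P\<close>: the adjoint has no values beyond those it takes on a separable set.\<close>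

lemma separable_range_cadjoint:
  assumes T: "T \<in> carrier \<B>" and sep: "separable (range (blinfun_apply T))"
  shows "separable (range (cadjoint T))"
proof -
  let ?M = "closure (range T)"
  obtain P where P: "P \<in> carrier \<B>" "cadjoint P = P" "range P \<subseteq> ?M" "\<And>x. x \<in> ?M \<Longrightarrow> P x = x"
    by (rule projection_operator[OF csubspace_closure[OF csubspace_range[OF T]] closed_closure])
      (rule that)
  have "P o\<^sub>L T = T"
    using closure_subset[of "range T"] by (intro blinfun_eqI) (simp add: P(4) subset_iff)
  then have "cadjoint T = cadjoint T o\<^sub>L P"
    using cadjoint_compose[OF P(1) T] P(2) by simp
  then have "cadjoint T x \<in> cadjoint T ` ?M" for x
    by (metis P(3) blinfun_apply_blinfun_compose image_eqI rangeI subsetD)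
  then show ?thesis
    by (intro separable_subset[OF separable_blinfun_image[OF separable_closure[OF sep]]]) blast
qed

text \<open>For the second inclusion, decompose \<^term>\<open>x\<close> along the closure of the range of the adjoint.  The
  component orthogonal to that range lies in the kernel of \<^term>\<open>T\<close>, hence is orthogonal to \<^term>\<open>x\<close>
  and to the other component of \<^term>\<open>x\<close>, so it vanishes.\<close>

lemma orthogonal_complement_op_kernel:
  assumes T: "T \<in> carrier \<B>"
  shows "range (cadjoint T) \<subseteq> orthogonal_complement (op_kernel T)"
    and "orthogonal_complement (op_kernel T) \<subseteq> closure (range (cadjoint T))"
proof -
  show "range (cadjoint T) \<subseteq> orthogonal_complement (op_kernel T)"
    using cinner_cadjoint_left[OF T] by (auto simp: orthogonal_complement_def op_kernel_def)
next
  show "orthogonal_complement (op_kernel T) \<subseteq> closure (range (cadjoint T))"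
  proof
    fix x assume x: "x \<in> orthogonal_complement (op_kernel T)"
    obtain y where y: "y \<in> closure (range (cadjoint T))"
      and orth: "x - y \<in> orthogonal_complement (closure (range (cadjoint T)))"
      using orthogonal_decomposition[OF csubspace_closure[OF csubspace_range[OF cadjoint_closed[OF T]]]]
      by blast
    have "cinner (T (x - y)) z = 0" for z
      using orth closure_subset[of "range (cadjoint T)"]
      by (simp flip: cinner_cadjoint_right[OF T] add: orthogonal_complement_def subset_iff)
    then have "T (x - y) = 0"
      by (intro cinner_eqI) simp
    then have "cinner x (x - y) = 0"
      using x by (simp add: orthogonal_complement_def op_kernel_def)
    moreover have "cinner (x - y) y = 0"
      using orth y by (simp add: orthogonal_complement_def)
    then have "cinner y (x - y) = 0"
      by (metis cinner_commute complex_cnj_zero)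
    ultimately have "cinner (x - y) (x - y) = 0"
      by (simp add: cinner_diff_left)
    then show "x \<in> closure (range (cadjoint T))"
      using y by (simp add: cinner_eq_zero_iff)
  qed
qed

lemma separable_orthogonal_complement_op_kernel_iff:
  assumes T: "T \<in> carrier \<B>"
  shows "separable (orthogonal_complement (op_kernel T)) \<longleftrightarrow> separable (range T)"
proof
  assume "separable (orthogonal_complement (op_kernel T))"
  then have "separable (range (cadjoint T))"
    by (rule separable_subset) (rule orthogonal_complement_op_kernel[OF T])
  from separable_range_cadjoint[OF cadjoint_closed[OF T] this]
  show "separable (range T)"
    by (simp only: cadjoint_cadjoint[OF T])
next
  assume "separable (range T)"
  from separable_closure[OF separable_range_cadjoint[OF T this]]
  show "separable (orthogonal_complement (op_kernel T))"
    by (rule separable_subset) (rule orthogonal_complement_op_kernel[OF T])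
qed

lemma separable_operators_simps [simp]:
  "zero \<A> = 0" "add \<A> = (+)" "scale \<A> = scaleC_blinfun" "mult \<A> = (o\<^sub>L)"
  "star \<A> = cadjoint" "nrm \<A> = norm"
  by (simp_all add: separable_operators_def bounded_operators_def)

lemma carrier_separable_operators:
  "T \<in> carrier \<A> \<longleftrightarrow> T \<in> carrier \<B> \<and> separable (range (blinfun_apply T))"
  using separable_orthogonal_complement_op_kernel_iff[of T]
  by (auto simp: separable_operators_def)

text \<open>The projection \<^term>\<open>h\<close> onto the closure of \<open>ran T + ran T*\<close> fixes the range of the adjoint as
  well, so that \<open>h T* = T*\<close>; passing to adjoints gives \<open>T h = T\<close>.\<close>

lemma ex_local_unit:
  assumes "T \<in> carrier \<A>"
  obtains h where "h \<in> carrier \<A>" "cadjoint h = h" "T o\<^sub>L h = T" "h o\<^sub>L T = T"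
proof -
  have T: "T \<in> carrier \<B>" and sep: "separable (range T)"
    using assms unfolding carrier_separable_operators by blast+
  define M where "M = closure (range T + range (cadjoint T))"
  have M: "csubspace M" "closed M"
    unfolding M_def
    by (intro csubspace_closure csubspace_plus csubspace_range T cadjoint_closed closed_closure)+
  have sepM: "separable M"
    unfolding M_def
    by (intro separable_closure separable_plus sep separable_range_cadjoint T)
  obtain P where P: "P \<in> carrier \<B>" "cadjoint P = P" "range P \<subseteq> M" "\<And>x. x \<in> M \<Longrightarrow> P x = x"
    by (rule projection_operator[OF M]) (rule that)
  have zero: "0 \<in> range T" "0 \<in> range (cadjoint T)"
    using csubspace_range[OF T] csubspace_range[OF cadjoint_closed[OF T]]
    by (simp_all add: csubspace_def)
  have "T x \<in> M" "cadjoint T x \<in> M" for x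
    using set_plus_intro[OF rangeI[of T x] zero(2)] set_plus_intro[OF zero(1) rangeI[of "cadjoint T" x]]
      closure_subset[of "range T + range (cadjoint T)"]
    by (auto simp: M_def)
  then have PT: "P o\<^sub>L T = T" and PT': "P o\<^sub>L cadjoint T = cadjoint T"
    by (auto intro!: blinfun_eqI P(4))
  have "T o\<^sub>L P = T"
    using arg_cong[OF PT', of cadjoint]
    by (simp only: cadjoint_compose[OF P(1) cadjoint_closed[OF T]] cadjoint_cadjoint[OF T] P(2))
  moreover have "P \<in> carrier \<A>"
    unfolding carrier_separable_operators using P(1,3) separable_subset[OF sepM] by blast
  ultimately show thesis
    using that P(2) PT by blast
qed

section \<open>The $C^*$-algebra of operators with separable range\<close>

text \<open>Values of a limit operator are limits of values, so its range lies in the closure of a countable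
  union of separable sets.\<close>

lemma closed_carrier_separable_operators: "closed (carrier \<A>)"
  unfolding closed_sequential_limits
proof (intro allI impI, elim conjE)
  fix T :: "nat \<Rightarrow> 'a \<Rightarrow>\<^sub>L 'a" and L
  assume T: "\<forall>n. T n \<in> carrier \<A>" and lim: "T \<longlonglongrightarrow> L"
  have lim_apply: "(\<lambda>n. T n x) \<longlonglongrightarrow> L x" for x
    by (intro tendsto_intros lim)
  have T_scaleC: "T n (c *\<^sub>C x) = c *\<^sub>C T n x" and T_sep: "separable (range (T n))" for n c x
    using T unfolding carrier_separable_operators carrier_bounded_operators by blast+
  have linear: "L (c *\<^sub>C x) = c *\<^sub>C L x" for c x
    using lim_apply[of "c *\<^sub>C x"]
      bounded_linear.tendsto[OF bounded_linear_scaleC_right lim_apply[of x], of c]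
    unfolding T_scaleC by (rule LIMSEQ_unique)
  have "L x \<in> closure (\<Union>n. range (T n))" for x
  proof (rule Lim_in_closed_set[OF closed_closure _ _ lim_apply])
    show "\<forall>\<^sub>F n in sequentially. T n x \<in> closure (\<Union>n. range (T n))"
      by (intro always_eventually allI subsetD[OF closure_subset]) blast
  qed simp
  then have "range L \<subseteq> closure (\<Union>n. range (T n))"
    by (rule image_subsetI)
  moreover have "separable (closure (\<Union>n. range (T n)))"
    by (intro separable_closure separable_countable_Union T_sep)
  ultimately have sep: "separable (range L)"
    by (metis separable_subset)
  from linear sep show "L \<in> carrier \<A>"
    by (simp only: carrier_separable_operators carrier_bounded_operators simp_thms)
qed

lemma separable_range_add:
  assumes "separable (range (blinfun_apply S))" and "separable (range (blinfun_apply T))"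
  shows "separable (range (blinfun_apply (S + T)))"
  by (rule separable_subset[OF separable_plus[OF assms]]) (auto simp: blinfun.add_left)

lemma separable_range_scaleC:
  assumes "separable (range (blinfun_apply T))"
  shows "separable (range (blinfun_apply (scaleC_blinfun c T)))"
  using separable_continuous_image[OF linear_continuous_on[OF bounded_linear_scaleC_right[of c]] assms]
  by (rule separable_subset) auto

lemma separable_range_compose:
  assumes "separable (range (blinfun_apply S))"
  shows "separable (range (blinfun_apply (S o\<^sub>L T)))"
  by (rule separable_subset[OF assms]) auto

lemma scaleC_blinfun_minus_one: "scaleC_blinfun (-1) T = - T"
  by (rule blinfun_eqI) (simp add: scaleC_minus_one blinfun.minus_left)

lemma norm_scaleC_blinfun: "norm (scaleC_blinfun c T) = cmod c * norm T"
proof -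
  \<comment> \<open>The converse inequality is this one for the inverse scalar.\<close>
  have le: "norm (scaleC_blinfun c T) \<le> cmod c * norm T" for c and T :: "'a \<Rightarrow>\<^sub>L 'a"
  proof (rule norm_blinfun_bound)
    show "norm (scaleC_blinfun c T x) \<le> cmod c * norm T * norm x" for x
      using mult_left_mono[OF norm_blinfun[of T x], of "cmod c"]
      by (simp add: norm_scaleC mult.assoc)
  qed simp
  show ?thesis
  proof (cases "c = 0")
    case True
    then show ?thesis
      using le[of 0 T] by simp
  next
    case False
    have "scaleC_blinfun (inverse c) (scaleC_blinfun c T) = T"
      using False by (intro blinfun_eqI) (simp add: scaleC_scaleC scaleC_one)
    then have "norm T \<le> cmod (inverse c) * norm (scaleC_blinfun c T)"
      by (metis le)
    then have "cmod c * norm T \<le> norm (scaleC_blinfun c T)"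
      using False by (simp add: norm_inverse norm_divide field_simps)
    then show ?thesis
      using le[of c T] by simp
  qed
qed

lemma closed_imp_mcomplete:
  fixes S :: "'a::complete_space set"
  assumes "closed S"
  shows "Metric_space.mcomplete S dist"
proof -
  interpret Metric_space S dist
    by (simp add: Met_TC.subspace)
  show ?thesis
    unfolding mcomplete_def
  proof (intro allI impI)
    fix s assume s: "MCauchy s"
    then have S: "s n \<in> S" for n
      by (auto simp: MCauchy_def)
    have "Cauchy s"
      using s by (simp add: MCauchy_def Cauchy_def)
    then obtain l where l: "s \<longlonglongrightarrow> l"
      using Cauchy_convergent convergent_def by metis
    have "l \<in> S"
      by (rule closed_sequentially[OF assms S l])
    moreover have "\<exists>N. \<forall>n\<ge>N. s n \<in> S \<and> dist (s n) l < e" if "e > 0" for e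
      using metric_LIMSEQ_D[OF l that] S by simp
    ultimately have "limitin mtopology s l sequentially"
      unfolding limit_metric_sequentially by simp
    then show "\<exists>l. limitin mtopology s l sequentially"
      by (rule exI)
  qed
qed

lemma cstar_algebra_separable_operators:
  "cstar_algebra (\<A> :: ('a::complex_hilbert_space \<Rightarrow>\<^sub>L 'a) star_algebra)"
proof (unfold_locales, unfold separable_operators_simps)
  show "(0 :: 'a \<Rightarrow>\<^sub>L 'a) \<in> carrier \<A>"
    by (auto simp: carrier_separable_operators carrier_bounded_operators separable_iff
        intro!: exI[of _ "{0}"])
  show "x + y \<in> carrier \<A>" if "x \<in> carrier \<A>" "y \<in> carrier \<A>" for x y :: "'a \<Rightarrow>\<^sub>L 'a"
    using that separable_range_add[of x y]
    by (simp add: carrier_separable_operators carrier_bounded_operators blinfun.add_left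
        scaleC_add_right)
  show scale: "scaleC_blinfun c x \<in> carrier \<A>" if "x \<in> carrier \<A>" for c and x :: "'a \<Rightarrow>\<^sub>L 'a"
    using that separable_range_scaleC[of x c]
    by (simp add: carrier_separable_operators carrier_bounded_operators scaleC_scaleC mult.commute)
  show "x o\<^sub>L y \<in> carrier \<A>" if "x \<in> carrier \<A>" "y \<in> carrier \<A>" for x y :: "'a \<Rightarrow>\<^sub>L 'a"
    using that separable_range_compose[of x y]
    by (simp add: carrier_separable_operators carrier_bounded_operators)
  show "cadjoint x \<in> carrier \<A>" if "x \<in> carrier \<A>" for x :: "'a \<Rightarrow>\<^sub>L 'a"
    using that cadjoint_closed[of x] separable_range_cadjoint[of x]
    by (simp add: carrier_separable_operators)
  show "\<exists>y\<in>carrier \<A>. x + y = 0" if "x \<in> carrier \<A>" for x :: "'a \<Rightarrow>\<^sub>L 'a"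
    using scale[OF that, of "-1"] by (metis scaleC_blinfun_minus_one add.right_inverse)
  show "Metric_space.mcomplete (carrier \<A>)
      (\<lambda>x y :: 'a \<Rightarrow>\<^sub>L 'a. norm (x + scaleC_blinfun (-1) y))"
  proof -
    have "(\<lambda>x y :: 'a \<Rightarrow>\<^sub>L 'a. norm (x + scaleC_blinfun (-1) y)) = dist"
      by (simp add: fun_eq_iff dist_norm scaleC_blinfun_minus_one)
    then show ?thesis
      using closed_imp_mcomplete[OF closed_carrier_separable_operators] by simp
  qed
qed (auto intro!: blinfun_eqI norm_triangle_ineq norm_blinfun_compose
    simp: carrier_separable_operators cadjoint_add cadjoint_scaleC cadjoint_compose cadjoint_cadjoint
      norm_cadjoint_compose norm_scaleC_blinfun blinfun.add_left blinfun.add_right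
      carrier_bounded_operators[THEN iffD1, rule_format]
      scaleC_add_right scaleC_add_left scaleC_scaleC scaleC_one)

section \<open>Non-existence of a unit\<close>

text \<open>For unit vectors this is the projection onto a line; leaving \<^term>\<open>x\<close> unnormalised spares a
  division, and \<^term>\<open>rank_one x x\<close> is still a nonzero multiple of \<^term>\<open>x\<close> if \<^term>\<open>x \<noteq> 0\<close>.\<close>

definition rank_one :: "'a::complex_hilbert_space \<Rightarrow> ('a \<Rightarrow>\<^sub>L 'a)"
  where "rank_one x = Blinfun (\<lambda>y. cinner y x *\<^sub>C x)"

lemma rank_one_apply: "rank_one x y = cinner y x *\<^sub>C x"
  unfolding rank_one_def
  by (rule bounded_linear_Blinfun_apply[THEN fun_cong])
    (rule bounded_linear_compose[OF bounded_linear_scaleC_left bounded_linear_cinner_left])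

lemma rank_one_in_carrier: "rank_one x \<in> carrier \<A>"
proof -
  have "separable (UNIV :: complex set)"
    unfolding separable_iff using separable by metis
  then have "separable (range (\<lambda>c. c *\<^sub>C x))"
    by (rule separable_continuous_image[OF linear_continuous_on[OF bounded_linear_scaleC_left]])
  then have "separable (range (rank_one x))"
    by (rule separable_subset) (auto simp: rank_one_apply)
  then show ?thesis
    by (simp add: carrier_separable_operators carrier_bounded_operators rank_one_apply
        cinner_scaleC_left scaleC_scaleC)
qed

text \<open>A unit fixes \<^term>\<open>rank_one x x\<close>, hence \<^term>\<open>x\<close>, for all \<^term>\<open>x\<close>; being the identity, it has
  all of \<open>H\<close> as its range.\<close>

lemma separable_UNIV_if_unital:
  assumes "unital (\<A> :: ('a::complex_hilbert_space \<Rightarrow>\<^sub>L 'a) star_algebra)"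
  shows "separable (UNIV :: 'a set)"
proof -
  obtain e :: "'a \<Rightarrow>\<^sub>L 'a" where e: "e \<in> carrier \<A>" and unit: "\<And>a. a \<in> carrier \<A> \<Longrightarrow> e o\<^sub>L a = a"
    using assms by (auto simp: unital_def)
  have "e x = x" for x
  proof (cases "x = 0")
    case False
    define c where "c = cinner x x"
    have "c \<noteq> 0"
      using False by (simp add: c_def cinner_eq_zero_iff)
    have "(e o\<^sub>L rank_one x) x = rank_one x x"
      by (simp only: unit[OF rank_one_in_carrier])
    then have "e (c *\<^sub>C x) = c *\<^sub>C x"
      by (simp add: rank_one_apply c_def)
    then have "c *\<^sub>C e x = c *\<^sub>C x"
      using e by (simp add: carrier_separable_operators carrier_bounded_operators)
    then have "inverse c *\<^sub>C c *\<^sub>C e x = inverse c *\<^sub>C c *\<^sub>C x"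
      by simp
    then show ?thesis
      using \<open>c \<noteq> 0\<close> by (simp add: scaleC_scaleC scaleC_one)
  qed (simp add: blinfun.zero_right)
  then have "range e = UNIV"
    by (metis surjI)
  then show ?thesis
    using e by (simp add: carrier_separable_operators)
qed

theorem theorem3p6:
  assumes "\<not> separable (UNIV :: 'h::complex_hilbert_space set)"
  shows "(\<forall>T \<in> carrier (\<B> :: ('h \<Rightarrow>\<^sub>L 'h) star_algebra).
           separable (orthogonal_complement (op_kernel T)) \<longleftrightarrow> separable (range T)) \<and>
         (\<forall>T \<in> carrier (\<A> :: ('h \<Rightarrow>\<^sub>L 'h) star_algebra).
           \<exists>h \<in> carrier \<A>. local_unit \<B> h T) \<and>
         cstar_algebra (\<A> :: ('h \<Rightarrow>\<^sub>L 'h) star_algebra) \<and>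
         \<not> unital (\<A> :: ('h \<Rightarrow>\<^sub>L 'h) star_algebra) \<and>
         locally_unital (\<A> :: ('h \<Rightarrow>\<^sub>L 'h) star_algebra)"
proof (intro conjI ballI)
  show "separable (orthogonal_complement (op_kernel T)) \<longleftrightarrow> separable (range T)"
    if "T \<in> carrier \<B>" for T :: "'h \<Rightarrow>\<^sub>L 'h"
    using that by (rule separable_orthogonal_complement_op_kernel_iff)
  show "\<exists>h \<in> carrier \<A>. local_unit \<B> h T" if T: "T \<in> carrier \<A>" for T :: "'h \<Rightarrow>\<^sub>L 'h"
  proof -
    obtain h where h: "h \<in> carrier \<A>" "cadjoint h = h" "T o\<^sub>L h = T" "h o\<^sub>L T = T"
      by (rule ex_local_unit[OF T]) (rule that)
    moreover have "h \<in> carrier \<B>"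
      using h(1) by (simp add: carrier_separable_operators)
    ultimately show ?thesis
      by (intro bexI[of _ h]) (auto simp: local_unit_def bounded_operators_def)
  qed
  show "cstar_algebra (\<A> :: ('h \<Rightarrow>\<^sub>L 'h) star_algebra)"
    by (rule cstar_algebra_separable_operators)
  show "\<not> unital (\<A> :: ('h \<Rightarrow>\<^sub>L 'h) star_algebra)"
    using assms separable_UNIV_if_unital by blast
  show "locally_unital (\<A> :: ('h \<Rightarrow>\<^sub>L 'h) star_algebra)"
    unfolding locally_unital_def local_unit_def separable_operators_simps
    by (metis ex_local_unit)
qed

end
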